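(* Let $r \ge 3$ be an integer, let $G$ be a (finite, simple) graph on $n$ vertices, and let $k \in \mathbb{R}$ be such that $e(G) = \left(1 - \frac{1}{r-1}\right)\frac{n^2}{2} + k$. Then $\nu_r^*(G) \ge \frac{2k}{r}$.
   Context: For a graph $G$, $e(G)$ denotes its number of edges and $\mathcal{K}_r(G)$ the set of $r$-cliques (complete subgraphs on $r$ vertices) of $G$. A fractional $r$-clique packing of $G$ is a map $f:\mathcal{K}_r(G)\to\mathbb{R}_{\ge 0}$ such that for every edge $e\in E(G)$, $\sum_{K\in\mathcal{K}_r(G),\, e\in E(K)} f(K)\le 1$. Its size is $\|f\|=\sum_{K\in\mathcal{K}_r(G)} f(K)$. The fractional $r$-clique packing number $\nu_r^*(G)$ is the maximum of $\|f\|$ over all fractional $r$-clique packings $f$ of $G$. *)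

theory Defs
  imports "HOL-Analysis.Analysis"
begin

definition simple_graph :: "'a set \<Rightarrow> 'a set set \<Rightarrow> bool" where
  "simple_graph V E \<longleftrightarrow> finite V \<and> (\<forall>e\<in>E. e \<subseteq> V \<and> card e = 2)"

text \<open>An \<open>r\<close>-clique is identified with its vertex set.\<close>

definition cliques :: "nat \<Rightarrow> 'a set \<Rightarrow> 'a set set \<Rightarrow> 'a set set" where
  "cliques r V E = {K. K \<subseteq> V \<and> card K = r \<and> (\<forall>u\<in>K. \<forall>v\<in>K. u \<noteq> v \<longrightarrow> {u, v} \<in> E)}"

text \<open>
  An edge \<open>e\<close> belongs to the clique on the vertex set \<open>K\<close> iff \<open>e \<subseteq> K\<close>.
  The values of \<open>f\<close> on sets that are not \<open>r\<close>-cliques are irrelevant.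
\<close>

definition fractional_clique_packing ::
    "nat \<Rightarrow> 'a set \<Rightarrow> 'a set set \<Rightarrow> ('a set \<Rightarrow> real) \<Rightarrow> bool" where
  "fractional_clique_packing r V E f \<longleftrightarrow>
     (\<forall>K\<in>cliques r V E. f K \<ge> 0) \<and>
     (\<forall>e\<in>E. (\<Sum>K\<in>{K\<in>cliques r V E. e \<subseteq> K}. f K) \<le> 1)"

definition packing_size :: "nat \<Rightarrow> 'a set \<Rightarrow> 'a set set \<Rightarrow> ('a set \<Rightarrow> real) \<Rightarrow> real" where
  "packing_size r V E f = (\<Sum>K\<in>cliques r V E. f K)"

text \<open>
  The maximum is written as a supremum; for \<open>r \<ge> 2\<close> it is attained, see
  \<open>fractional_clique_packing_number_is_max\<close> below.
\<close>

definition fractional_clique_packing_number :: "nat \<Rightarrow> 'a set \<Rightarrow> 'a set set \<Rightarrow> real" where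
  "fractional_clique_packing_number r V E =
     Sup {packing_size r V E f | f. fractional_clique_packing r V E f}"

lemma finite_cliques: "simple_graph V E \<Longrightarrow> finite (cliques r V E)"
  by (rule finite_subset[of _ "Pow V"]) (auto simp: cliques_def simple_graph_def)

lemma fractional_clique_packing_le_1:
  assumes G: "simple_graph V E" and r: "r \<ge> 2"
    and f: "fractional_clique_packing r V E f" and K: "K \<in> cliques r V E"
  shows "f K \<le> 1"
proof -
  have "card K \<ge> 2" using K r by (auto simp: cliques_def)
  then obtain T where T: "T \<subseteq> K" "card T = 2"
    by (meson obtain_subset_with_card_n)
  then obtain u v where uv: "T = {u, v}" "u \<noteq> v"
    by (auto simp: card_2_iff)
  have e: "T \<in> E" using K T uv by (auto simp: cliques_def)
  have "f K \<le> (\<Sum>K\<in>{K\<in>cliques r V E. T \<subseteq> K}. f K)"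
    using K T f by (intro member_le_sum)
      (auto simp: fractional_clique_packing_def intro: finite_subset[OF _ finite_cliques[OF G]])
  also have "\<dots> \<le> 1" using f e by (auto simp: fractional_clique_packing_def)
  finally show ?thesis .
qed

lemma fractional_clique_packing_number_is_max:
  assumes G: "simple_graph V E" and r: "r \<ge> 2"
  shows "\<exists>f. fractional_clique_packing r V E f \<and>
           packing_size r V E f = fractional_clique_packing_number r V E"
    and "fractional_clique_packing r V E g \<Longrightarrow>
           packing_size r V E g \<le> fractional_clique_packing_number r V E"
proof -
  define C where "C = cliques r V E"
  define B where "B = (\<Pi>\<^sub>E K\<in>UNIV. if K \<in> C then {0..1::real} else {0})"
  define P where "P = B \<inter> (\<Inter>e\<in>E. {f. (\<Sum>K\<in>{K\<in>C. e \<subseteq> K}. f K) \<le> 1})"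
  have "compactin (product_topology (\<lambda>_. euclidean) UNIV) B"
    unfolding B_def by (subst compactin_PiE) auto
  then have "compact B" by (simp add: euclidean_product_topology)
  moreover have "closed {f. (\<Sum>K\<in>{K\<in>C. e \<subseteq> K}. f K) \<le> (1::real)}" for e
    by (intro closed_Collect_le continuous_intros continuous_on_product_coordinates)
  ultimately have "compact P"
    unfolding P_def by (intro compact_Int_closed closed_INT) auto
  moreover have "(\<lambda>_. 0) \<in> P" by (auto simp: P_def B_def)
  then have "P \<noteq> {}" by blast
  moreover have "continuous_on P (packing_size r V E)"
    unfolding packing_size_def
    by (intro continuous_intros continuous_on_product_coordinates[THEN continuous_on_subset]) auto
  ultimately have "\<exists>m\<in>P. \<forall>f\<in>P. packing_size r V E f \<le> packing_size r V E m"
    by (rule continuous_attains_sup)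
  then obtain m where m: "m \<in> P" "\<And>f. f \<in> P \<Longrightarrow> packing_size r V E f \<le> packing_size r V E m"
    by blast
  have "m K \<ge> 0" if "K \<in> C" for K
  proof -
    have "m K \<in> (if K \<in> C then {0..1} else {0})"
      using m(1) unfolding P_def B_def PiE_iff by blast
    then show ?thesis using that by simp
  qed
  with m(1) have mp: "fractional_clique_packing r V E m"
    by (simp add: P_def C_def fractional_clique_packing_def)
  have mx: "packing_size r V E f \<le> packing_size r V E m" if f: "fractional_clique_packing r V E f" for f
  proof -
    define f' where "f' = (\<lambda>K. if K \<in> C then f K else 0)"
    have s: "(\<Sum>K\<in>A. f' K) = (\<Sum>K\<in>A. f K)" if "A \<subseteq> C" for A
      using that by (intro sum.cong) (auto simp: f'_def)
    have "f' \<in> P"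
      using f fractional_clique_packing_le_1[OF G r f]
      by (auto simp: P_def B_def s) (auto simp: f'_def C_def fractional_clique_packing_def)
    then have "packing_size r V E f' \<le> packing_size r V E m" by (rule m(2))
    moreover have "packing_size r V E f' = packing_size r V E f"
      using s[of C] by (simp add: packing_size_def C_def)
    ultimately show ?thesis by simp
  qed
  have eq: "fractional_clique_packing_number r V E = packing_size r V E m"
    unfolding fractional_clique_packing_number_def
    by (rule cSup_eq_maximum) (use mp mx in auto)
  show "\<exists>f. fractional_clique_packing r V E f \<and>
           packing_size r V E f = fractional_clique_packing_number r V E"
    using mp eq by auto
  show "fractional_clique_packing r V E g \<Longrightarrow>
           packing_size r V E g \<le> fractional_clique_packing_number r V E"
    using mx eq by simp
qed

end

theory Submission
  imports Defs
begin

text \<open>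
  By linear programming duality it suffices to bound below the total weight of a fractional cover
  \<open>w\<close> of the \<open>r\<close>-cliques by edges. With \<open>a u v = 1 - r / 2 * w {u, v}\<close> on edges and \<open>0\<close> elsewhere,
  this becomes a weighted Turan bound in the style of Motzkin and Straus: the quadratic form of
  \<open>a\<close> is at most \<open>(r - 2) / (r - 1)\<close> on the simplex. At a maximiser \<open>x\<close> of smallest support \<open>S\<close>,
  all \<open>a u v\<close> on \<open>S\<close> are positive, and the Lagrange conditions say that \<open>x\<close> annihilates the
  matrix \<open>l - a u v\<close>, where \<open>l\<close> is the maximum. If \<open>l\<close> exceeded the bound, this would allow one
  to choose greedily \<open>r\<close> distinct vertices of \<open>S\<close> on which \<open>a\<close> is too heavy.

  Duality is obtained up to a factor \<open>1 + 1 / M\<close> by maximising the size of a packing minus \<open>M / 2\<close>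
  times the squared overload of the edges: at a maximiser, \<open>M\<close> times the overload is a cover, and
  complementary slackness compares its weight with the size of the packing.
\<close>

section \<open>One-sided first-order conditions and compactness\<close>

text \<open>Divide by \<open>h\<close> and let \<open>h\<close> tend to 0. This replaces
  differentiation at a maximiser, where a perturbation of size \<open>h\<close> may be admissible in
  one direction only.\<close>

lemma quadratic_bound_imp_nonpos:
  fixes c C d :: real
  assumes d: "d > 0" and le: "\<And>h. 0 < h \<Longrightarrow> h \<le> d \<Longrightarrow> h * c \<le> C * h\<^sup>2"
  shows "c \<le> 0"
proof (rule ccontr)
  assume "\<not> c \<le> 0"
  then have c: "c > 0" by simp
  \<comment> \<open>With this choice \<open>C * h\<close> is at most \<open>c / 2\<close>, against
    \<open>c <= C * h\<close>.\<close>
  define h where "h = min d (c / (2 * (\<bar>C\<bar> + 1)))"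
  have h: "h > 0" "h \<le> d" using c d by (auto simp: h_def)
  have "h * c \<le> C * h\<^sup>2" by (rule le[OF h])
  then have "h * c \<le> h * (C * h)" by (simp add: power2_eq_square mult_ac)
  then have "c \<le> C * h" using h by simp
  also have "\<dots> \<le> (\<bar>C\<bar> + 1) * (c / (2 * (\<bar>C\<bar> + 1)))"
    using h by (intro mult_mono) (auto simp: h_def)
  also have "\<dots> = c / 2" by (simp add: field_simps)
  finally show False using c by simp
qed

lemma compact_PiE_UNIV:
  assumes "\<And>i. compact (X i :: real set)"
  shows "compact (\<Pi>\<^sub>E i\<in>(UNIV :: 'a set). X i)"
proof -
  have "compactin (product_topology (\<lambda>_::'a. euclidean) UNIV) (\<Pi>\<^sub>E i\<in>UNIV. X i)"
    using assms by (subst compactin_PiE) auto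
  then show ?thesis by (simp add: euclidean_product_topology)
qed

section \<open>Quadratic forms on the simplex\<close>

text \<open>Points are total functions; pinning them to 0 off \<open>V\<close> places the simplex
  inside a product of compact sets.\<close>

definition weight_simplex :: "'a set \<Rightarrow> ('a \<Rightarrow> real) set" where
  "weight_simplex V = {x. (\<forall>v\<in>V. 0 \<le> x v) \<and> (\<forall>v. v \<notin> V \<longrightarrow> x v = 0) \<and> sum x V = 1}"

lemma compact_weight_simplex:
  assumes "finite V"
  shows "compact (weight_simplex V)"
proof -
  define B where "B = (\<Pi>\<^sub>E v\<in>UNIV. if v \<in> V then {0..1::real} else {0})"
  have "x v \<le> 1" if "x \<in> weight_simplex V" "v \<in> V" for x v
    using that assms member_le_sum[of v V x] by (auto simp: weight_simplex_def)
  then have "weight_simplex V = B \<inter> {x. sum x V = 1}"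
    by (auto simp: weight_simplex_def B_def PiE_iff split: if_splits)
  moreover have "compact B"
    unfolding B_def by (intro compact_PiE_UNIV) auto
  moreover have "closed {x :: 'a \<Rightarrow> real. sum x V = 1}"
    by (intro closed_Collect_eq continuous_intros continuous_on_product_coordinates)
  ultimately show ?thesis by (simp add: compact_Int_closed)
qed

definition quad_form :: "'a set \<Rightarrow> ('a \<Rightarrow> 'a \<Rightarrow> real) \<Rightarrow> ('a \<Rightarrow> real) \<Rightarrow> real" where
  "quad_form V a x = (\<Sum>u\<in>V. \<Sum>v\<in>V. x u * x v * a u v)"

text \<open>For symmetric \<open>a\<close> this is half the gradient of \<open>quad_form V a\<close>
  at \<open>x\<close>.\<close>

definition grad :: "'a set \<Rightarrow> ('a \<Rightarrow> 'a \<Rightarrow> real) \<Rightarrow> ('a \<Rightarrow> real) \<Rightarrow> 'a \<Rightarrow> real" where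
  "grad V a x u = (\<Sum>v\<in>V. a u v * x v)"

text \<open>Moves weight \<open>t\<close> from \<open>v\<close> to \<open>u\<close>. Written as a
  difference of indicators, it changes nothing when \<open>u = v\<close>, so that case needs no
  separate treatment.\<close>

definition shift :: "'a \<Rightarrow> 'a \<Rightarrow> real \<Rightarrow> ('a \<Rightarrow> real) \<Rightarrow> 'a \<Rightarrow> real" where
  "shift u v t x = (\<lambda>i. x i + t * (of_bool (i = u) - of_bool (i = v)))"

text \<open>Second-order expansion in the direction \<open>d\<close>, the difference of the unit
  vectors at \<open>u\<close> and \<open>v\<close>. Its quadratic term
  \<open>a u u + a v v - 2 * a u v\<close> reduces to \<open>- 2 * a u v\<close> on a zero
  diagonal.\<close>

lemma quad_form_shift:
  assumes V: "finite V" and sym: "\<And>u v. a u v = a v u" and diag: "\<And>u. a u u = 0"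
    and uv: "u \<in> V" "v \<in> V"
  shows "quad_form V a (shift u v t x)
    = quad_form V a x + 2 * t * (grad V a x u - grad V a x v) - 2 * t\<^sup>2 * a u v"
proof -
  define d :: "'a \<Rightarrow> real" where "d = (\<lambda>i. of_bool (i = u) - of_bool (i = v))"
  have shift_eq: "shift u v t x i = x i + t * d i" for i by (simp add: shift_def d_def)
  have d: "(\<Sum>i\<in>V. d i * c i) = c u - c v" for c
  proof -
    have "d i * c i = (if i = u then c i else 0) - (if i = v then c i else 0)" for i
      by (simp add: d_def)
    then show ?thesis using V uv by (simp add: sum_subtractf)
  qed
  have "quad_form V a (shift u v t x) =
      (\<Sum>i\<in>V. \<Sum>j\<in>V. x i * x j * a i j + t * (d i * (a i j * x j))
         + t * (d j * (a j i * x i)) + t\<^sup>2 * (d i * (d j * a i j)))"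
    unfolding quad_form_def
    by (intro sum.cong refl) (simp add: shift_eq algebra_simps power2_eq_square sym)
  also have "\<dots> = quad_form V a x + t * (\<Sum>i\<in>V. d i * grad V a x i)
      + t * (\<Sum>i\<in>V. \<Sum>j\<in>V. d j * (a j i * x i)) + t\<^sup>2 * (\<Sum>i\<in>V. d i * (\<Sum>j\<in>V. d j * a i j))"
    by (simp add: quad_form_def grad_def sum.distrib sum_distrib_left)
  also have "(\<Sum>i\<in>V. \<Sum>j\<in>V. d j * (a j i * x i)) = (\<Sum>i\<in>V. d i * grad V a x i)"
    by (subst sum.swap) (simp add: grad_def sum_distrib_left)
  finally show ?thesis
    by (simp add: d diag sym[of v u])
qed

lemma shift_in_weight_simplex:
  assumes V: "finite V" and x: "x \<in> weight_simplex V" and uv: "u \<in> V" "v \<in> V"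
    and t: "0 \<le> t" "t \<le> x v"
  shows "shift u v t x \<in> weight_simplex V"
proof -
  have "0 \<le> shift u v t x i" if "i \<in> V" for i
    using x t that by (auto simp: weight_simplex_def shift_def)
  moreover have "shift u v t x i = 0" if "i \<notin> V" for i
    using x uv that by (auto simp: weight_simplex_def shift_def)
  moreover have "sum (shift u v t x) V = sum x V"
    using V uv by (simp add: shift_def sum.distrib sum_distrib_left[symmetric] sum_subtractf of_bool_def)
  ultimately show ?thesis using x by (simp add: weight_simplex_def)
qed

section \<open>The weighted Motzkin-Straus bound\<close>

text \<open>Induction on \<open>m\<close>. On \<open>S\<close> the rows of the matrix
  \<open>l - a u v\<close> are orthogonal to \<open>x\<close>, so some vertex has a nonpositive row
  sum over \<open>R\<close>. Adding it to \<open>R\<close> raises the double sum by twice that row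
  sum plus the diagonal entry \<open>l\<close>.\<close>

lemma greedy_set:
  fixes a :: "'a \<Rightarrow> 'a \<Rightarrow> real"
  assumes S: "finite S" "S \<noteq> {}" and x: "\<And>v. v \<in> S \<Longrightarrow> x v > 0" and sum_x: "sum x S = 1"
    and sym: "\<And>u v. a u v = a v u" and diag: "\<And>u. a u u = 0" and le1: "\<And>u v. a u v \<le> 1"
    and grad: "\<And>u. u \<in> S \<Longrightarrow> grad S a x u = l"
    and r: "r \<ge> 2" and l: "l > (real r - 2) / (real r - 1)" and m: "m \<le> r"
  shows "\<exists>R\<subseteq>S. card R = m \<and> (\<Sum>u\<in>R. \<Sum>v\<in>R. l - a u v) \<le> real m * l"
  using m
proof (induction m)
  case 0
  show ?case by (rule exI[of _ "{}"]) simp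
next
  case (Suc m)
  then obtain R where R: "R \<subseteq> S" "card R = m"
    and le: "(\<Sum>u\<in>R. \<Sum>v\<in>R. l - a u v) \<le> real m * l" by auto
  have fin: "finite R" using R S finite_subset by blast
  define s where "s v = (\<Sum>u\<in>R. l - a u v)" for v
  have "(\<Sum>v\<in>S. x v * s v) = (\<Sum>u\<in>R. \<Sum>v\<in>S. x v * (l - a u v))"
    by (subst sum.swap) (simp add: s_def sum_distrib_left)
  also have "\<dots> = (\<Sum>u\<in>R. (\<Sum>v\<in>S. x v * l) - grad S a x u)"
    by (simp add: grad_def right_diff_distrib sum_subtractf sum_distrib_right mult.commute)
  also have "\<dots> = 0" using R grad by (intro sum.neutral) (auto simp: sum_distrib_right[symmetric] sum_x)
  finally have zero: "(\<Sum>v\<in>S. x v * s v) = 0" .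
  \<comment> \<open>The \<open>x\<close>-average of \<open>s\<close> vanishes and \<open>s\<close> is positive on \<open>R\<close>, so \<open>s v \<le> 0\<close> for some \<open>v\<close> outside \<open>R\<close>.\<close>
  have pos: "s v > 0" if v: "v \<in> R" for v
  proof -
    have m1: "m \<ge> 1" using R v fin by (auto simp: Suc_le_eq card_gt_0_iff)
    have "real m * l > real m * ((real r - 2) / (real r - 1))"
      using l m1 by (intro mult_strict_left_mono) auto
    \<comment> \<open>Equivalent to \<open>m <= r - 1\<close>, that is, to
      \<open>Suc m <= r\<close>. The quantity \<open>m * l - m + 1\<close> equals
      \<open>l + (m - 1) * (l - 1)\<close>, a lower bound for \<open>s v\<close> on
      \<open>R\<close>.\<close>
    moreover have "real m * ((real r - 2) / (real r - 1)) \<ge> real m - 1"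
      using r Suc.prems by (simp add: field_simps)
    ultimately have *: "real m * l - real m + 1 > 0" by linarith
    have "s v = l + (\<Sum>u\<in>R - {v}. l - a u v)"
      using v fin by (simp add: s_def sum.remove[of R v] diag)
    moreover have "(\<Sum>u\<in>R - {v}. l - a u v) \<ge> (\<Sum>u\<in>R - {v}. l - 1)"
      using le1 by (intro sum_mono) simp
    moreover have "(\<Sum>u\<in>R - {v}. l - 1) = (real m - 1) * (l - 1)"
      using v fin R m1 by (simp add: of_nat_diff)
    ultimately show ?thesis using * by (simp add: algebra_simps)
  qed
  have "\<exists>v\<in>S - R. s v \<le> 0"
  proof (rule ccontr)
    assume "\<not> ?thesis"
    then have "s v > 0" if "v \<in> S" for v using that pos by force
    then have "(\<Sum>v\<in>S. x v * s v) > 0" using S x by (intro sum_pos) auto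
    then show False using zero by simp
  qed
  then obtain v where v: "v \<in> S" "v \<notin> R" "s v \<le> 0" by auto
  have "(\<Sum>u\<in>insert v R. \<Sum>w\<in>insert v R. l - a u w)
      = (\<Sum>u\<in>R. \<Sum>w\<in>R. l - a u w) + 2 * s v + l"
    using v fin by (simp add: sum.distrib s_def diag sym[of v])
  then have "(\<Sum>u\<in>insert v R. \<Sum>w\<in>insert v R. l - a u w) \<le> real (Suc m) * l"
    using le v by (simp add: algebra_simps)
  then show ?case using v R fin by (intro exI[of _ "insert v R"]) auto
qed

text \<open>For the adjacency matrix of a graph, the assumption on \<open>R\<close> says that there
  is no \<open>r\<close>-clique, and the conclusion is the classical Motzkin-Straus bound.\<close>

lemma weighted_Motzkin_Straus:
  fixes a :: "'a \<Rightarrow> 'a \<Rightarrow> real"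
  assumes V: "finite V"
    and sym: "\<And>u v. a u v = a v u" and diag: "\<And>u. a u u = 0" and le1: "\<And>u v. a u v \<le> 1"
    and r: "r \<ge> 2"
    and cl: "\<And>R. R \<subseteq> V \<Longrightarrow> card R = r \<Longrightarrow> (\<And>u v. u \<in> R \<Longrightarrow> v \<in> R \<Longrightarrow> u \<noteq> v \<Longrightarrow> a u v > 0)
        \<Longrightarrow> (\<Sum>u\<in>R. \<Sum>v\<in>R. a u v) \<le> real r * (real r - 2)"
    and y: "y \<in> weight_simplex V"
  shows "quad_form V a y \<le> (real r - 2) / (real r - 1)"
proof -
  have "continuous_on (weight_simplex V) (quad_form V a)"
    unfolding quad_form_def
    by (intro continuous_intros continuous_on_product_coordinates[THEN continuous_on_subset]) auto
  then obtain x0 where x0: "x0 \<in> weight_simplex V" "\<And>z. z \<in> weight_simplex V \<Longrightarrow> quad_form V a z \<le> quad_form V a x0"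
    using continuous_attains_sup[OF compact_weight_simplex[OF V]] y by blast
  define M where "M = {x \<in> weight_simplex V. \<forall>z\<in>weight_simplex V. quad_form V a z \<le> quad_form V a x}"
  define x where "x = arg_min (\<lambda>x. card {v\<in>V. x v > 0}) (\<lambda>x. x \<in> M)"
  have "x0 \<in> M" using x0 by (auto simp: M_def)
  then have xM: "x \<in> M" and xmin: "\<And>z. z \<in> M \<Longrightarrow> card {v\<in>V. x v > 0} \<le> card {v\<in>V. z v > 0}"
    using arg_min_nat_lemma[of "\<lambda>x. x \<in> M" x0 "\<lambda>x. card {v\<in>V. x v > 0}"] by (auto simp: x_def)
  then have xS: "x \<in> weight_simplex V" and max: "\<And>z. z \<in> weight_simplex V \<Longrightarrow> quad_form V a z \<le> quad_form V a x"
    by (auto simp: M_def)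
  define S where "S = {v\<in>V. x v > 0}"
  define l where "l = quad_form V a x"
  have S: "finite S" "S \<subseteq> V" and xp: "\<And>v. v \<in> S \<Longrightarrow> x v > 0" using V by (auto simp: S_def)
  have x_zero: "x v = 0" if "v \<in> V - S" for v using that xS by (force simp: S_def weight_simplex_def)
  have sum_S: "(\<Sum>v\<in>S. c v) = (\<Sum>v\<in>V. c v)" if "\<And>v. x v = 0 \<Longrightarrow> c v = 0" for c :: "'a \<Rightarrow> real"
    using S V x_zero that by (intro sum.mono_neutral_left) auto
  have sum_x: "sum x S = 1" using xS sum_S[of x] by (simp add: weight_simplex_def)
  have "grad V a x u - grad V a x v \<le> 0" if uv: "u \<in> S" "v \<in> S" for u v
  proof (rule quadratic_bound_imp_nonpos[of "x v" _ "a u v"])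
    fix h assume h: "0 < h" "h \<le> x v"
    have "quad_form V a (shift u v h x) \<le> quad_form V a x"
      using uv S h by (intro max shift_in_weight_simplex[OF V xS]) auto
    then show "h * (grad V a x u - grad V a x v) \<le> a u v * h\<^sup>2"
      using uv S by (subst (asm) quad_form_shift[OF V sym diag]) (auto simp: mult.commute)
  qed (use uv xp in auto)
  then have g_eq: "grad V a x u = grad V a x v" if "u \<in> S" "v \<in> S" for u v
    using that by (meson antisym diff_le_0_iff_le)
  have l_eq: "grad V a x u = l" if u: "u \<in> S" for u
  proof -
    \<comment> \<open>Euler's identity for a quadratic form: the common value of the gradient on the
      support must be the value of the form.\<close>
    have "l = (\<Sum>i\<in>V. x i * grad V a x i)"
      by (simp add: l_def quad_form_def grad_def sum_distrib_left mult_ac)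
    also have "\<dots> = (\<Sum>i\<in>S. x i * grad V a x i)" by (rule sum_S[symmetric]) simp
    also have "\<dots> = (\<Sum>i\<in>S. x i * grad V a x u)" by (intro sum.cong refl) (metis g_eq u)
    also have "\<dots> = grad V a x u" by (simp add: sum_distrib_right[symmetric] sum_x)
    finally show ?thesis by simp
  qed
  have grad_S: "grad S a x u = l" if "u \<in> S" for u
    using l_eq[OF that] by (simp add: grad_def sum_S)
  have apos: "a u v > 0" if uv: "u \<in> S" "v \<in> S" "u \<noteq> v" for u v
  proof (rule ccontr)
    assume na: "\<not> a u v > 0"
    \<comment> \<open>Move all the weight of \<open>v\<close> to \<open>u\<close>. The linear term
      vanishes because the gradients agree, and the quadratic term is nonnegative if
      \<open>a u v <= 0\<close>; so \<open>z\<close> is again a maximiser, but its support has lost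
      \<open>v\<close>.\<close>
    define z where "z = shift u v (x v) x"
    have uvV: "u \<in> V" "v \<in> V" using uv S by auto
    have zS: "z \<in> weight_simplex V"
      unfolding z_def using uv xp uvV by (intro shift_in_weight_simplex[OF V xS]) (auto simp: less_imp_le)
    have "quad_form V a z \<ge> quad_form V a x"
      using na uv l_eq by (simp add: z_def quad_form_shift[OF V sym diag uvV] mult_nonneg_nonpos)
    then have "z \<in> M" using zS max by (auto simp: M_def intro: order_trans)
    then have "card S \<le> card {v\<in>V. z v > 0}" using xmin by (simp add: S_def)
    moreover have "{v\<in>V. z v > 0} \<subseteq> S - {v}"
      using uv by (auto simp: z_def shift_def S_def split: if_splits)
    then have "card {v\<in>V. z v > 0} \<le> card (S - {v})" using S by (intro card_mono) auto
    moreover have "card (S - {v}) < card S" using S uv by (intro card_Diff1_less) auto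
    ultimately show False by simp
  qed
  have "l \<le> (real r - 2) / (real r - 1)"
  proof (rule ccontr)
    assume "\<not> ?thesis"
    then have l: "l > (real r - 2) / (real r - 1)" by simp
    have ne: "S \<noteq> {}" using sum_x by auto
    from greedy_set[OF S(1) ne xp sum_x sym diag le1 grad_S r l order_refl]
    obtain R where R: "R \<subseteq> S" "card R = r"
      and le: "(\<Sum>u\<in>R. \<Sum>v\<in>R. l - a u v) \<le> real r * l" by blast
    have "(\<Sum>u\<in>R. \<Sum>v\<in>R. a u v) \<le> real r * (real r - 2)"
      using R S by (intro cl apos) auto
    moreover have "(\<Sum>u\<in>R. \<Sum>v\<in>R. l - a u v) = real r * (real r * l) - (\<Sum>u\<in>R. \<Sum>v\<in>R. a u v)"
      using R by (simp add: sum_subtractf)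
    ultimately have "real r * (real r * l) \<le> real r * (real r - 2 + l)"
      using le by (simp add: algebra_simps)
    then have "real r * l \<le> real r - 2 + l" using r by (subst (asm) mult_le_cancel_left_pos) auto
    then have "(real r - 1) * l \<le> real r - 2" by (simp add: algebra_simps)
    then show False using l r by (simp add: field_simps)
  qed
  then show ?thesis using max[OF y] by (simp add: l_def)
qed

section \<open>Fractional covers of cliques by edges\<close>

lemma sum_pairs_eq_sum_edges:
  fixes F :: "'a set \<Rightarrow> real"
  assumes R: "finite R" and E: "\<And>e. e \<in> E \<Longrightarrow> card e = 2"
  shows "(\<Sum>u\<in>R. \<Sum>v\<in>R. if {u, v} \<in> E then F {u, v} else 0) = 2 * (\<Sum>e\<in>{e\<in>E. e \<subseteq> R}. F e)"
proof -
  define P where "P = {p \<in> R \<times> R. {fst p, snd p} \<in> E}"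
  define D where "D = {e\<in>E. e \<subseteq> R}"
  have fin: "finite P" "finite D" using R by (auto simp: P_def D_def)
  have "(\<Sum>u\<in>R. \<Sum>v\<in>R. if {u, v} \<in> E then F {u, v} else 0)
      = (\<Sum>p\<in>R \<times> R. if {fst p, snd p} \<in> E then F {fst p, snd p} else 0)"
    by (simp add: sum.cartesian_product case_prod_beta)
  also have "\<dots> = (\<Sum>p\<in>P. F {fst p, snd p})"
    unfolding P_def using R by (subst sum.inter_filter) auto
  also have "\<dots> = (\<Sum>e\<in>D. \<Sum>p\<in>{p \<in> P. {fst p, snd p} = e}. F {fst p, snd p})"
    by (rule sum.group[symmetric]) (use fin in \<open>auto simp: P_def D_def\<close>)
  also have "\<dots> = (\<Sum>e\<in>D. 2 * F e)"
  proof (rule sum.cong)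
    fix e assume e: "e \<in> D"
    then obtain u v where uv: "e = {u, v}" "u \<noteq> v" using E[of e] by (auto simp: D_def card_2_iff)
    have "{p \<in> P. {fst p, snd p} = e} = {(u, v), (v, u)}"
      using e uv by (auto simp: P_def D_def doubleton_eq_iff insert_commute)
    then show "(\<Sum>p\<in>{p \<in> P. {fst p, snd p} = e}. F {fst p, snd p}) = 2 * F e"
      using uv by (simp add: insert_commute)
  qed simp
  finally show ?thesis by (simp add: D_def sum_distrib_left)
qed

text \<open>The weighted bound is evaluated at the uniform point of the simplex, where the form is a
  pair sum divided by \<open>n^2\<close>.\<close>

lemma fractional_clique_cover_ge:
  assumes r: "r \<ge> 2" and G: "simple_graph V E"
    and w: "\<And>e. e \<in> E \<Longrightarrow> w e \<ge> 0"
    and cover: "\<And>K. K \<in> cliques r V E \<Longrightarrow> (\<Sum>e\<in>{e\<in>E. e \<subseteq> K}. w e) \<ge> (1::real)"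
  shows "real (card E) - (real r - 2) / (real r - 1) * ((real (card V))\<^sup>2 / 2) \<le> real r / 2 * sum w E"
proof (cases "V = {}")
  case True
  then have "E = {}" using G by (auto simp: simple_graph_def)
  then show ?thesis using True by simp
next
  case False
  have V: "finite V" and E: "\<And>e. e \<in> E \<Longrightarrow> e \<subseteq> V" "\<And>e. e \<in> E \<Longrightarrow> card e = 2"
    using G by (auto simp: simple_graph_def)
  define n where "n = real (card V)"
  have n: "n > 0" using V False by (simp add: n_def card_gt_0_iff)
  \<comment> \<open>The factor \<open>r / 2\<close> is chosen so that a cover weight of 1 inside an
    \<open>r\<close>-clique lowers its sum over ordered pairs from \<open>r * (r - 1)\<close> to
    \<open>r * (r - 2)\<close>. The value 0 off \<open>E\<close> makes every set with positive
    entries a clique.\<close>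
  define a where "a u v = (if {u, v} \<in> E then 1 - real r / 2 * w {u, v} else 0)" for u v
  have ne: "{u, u} \<notin> E" for u using E(2)[of "{u, u}"] by auto
  have "quad_form V a (\<lambda>v. if v \<in> V then 1 / n else 0) \<le> (real r - 2) / (real r - 1)"
  proof (rule weighted_Motzkin_Straus[OF V _ _ _ r])
    show "a u v = a v u" for u v by (simp add: a_def insert_commute)
    show "a u u = 0" for u using ne[of u] by (simp add: a_def)
    show "a u v \<le> 1" for u v using w by (simp add: a_def)
    show "(\<lambda>v. if v \<in> V then 1 / n else 0) \<in> weight_simplex V"
      using n by (auto simp: weight_simplex_def n_def)
    fix R assume R: "R \<subseteq> V" "card R = r" and pos: "\<And>u v. u \<in> R \<Longrightarrow> v \<in> R \<Longrightarrow> u \<noteq> v \<Longrightarrow> a u v > 0"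
    have edge: "{u, v} \<in> E \<longleftrightarrow> u \<noteq> v" if "u \<in> R" "v \<in> R" for u v
      using pos[OF that] ne[of u] by (auto simp: a_def split: if_splits)
    then have K: "R \<in> cliques r V E" using R by (auto simp: cliques_def)
    have fin: "finite R" using R V finite_subset by blast
    have "(\<Sum>u\<in>R. \<Sum>v\<in>R. a u v) =
        (\<Sum>u\<in>R. \<Sum>v\<in>R. 1 - of_bool (u = v) - real r / 2 * (if {u, v} \<in> E then w {u, v} else 0))"
      using edge by (intro sum.cong) (auto simp: a_def)
    also have "\<dots> = real r * real r - real r
        - real r / 2 * (\<Sum>u\<in>R. \<Sum>v\<in>R. if {u, v} \<in> E then w {u, v} else 0)"
      using R fin by (simp add: sum_subtractf sum_distrib_left of_bool_def right_diff_distrib)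
    also have "\<dots> = real r * real r - real r - real r * (\<Sum>e\<in>{e\<in>E. e \<subseteq> R}. w e)"
      by (subst sum_pairs_eq_sum_edges[OF fin E(2)]) auto
    also have "\<dots> \<le> real r * real r - real r - real r * 1"
      using cover[OF K] by (intro diff_left_mono mult_left_mono) auto
    finally show "(\<Sum>u\<in>R. \<Sum>v\<in>R. a u v) \<le> real r * (real r - 2)" by (simp add: algebra_simps)
  qed
  also have "quad_form V a (\<lambda>v. if v \<in> V then 1 / n else 0) = (\<Sum>u\<in>V. \<Sum>v\<in>V. a u v) / n\<^sup>2"
    by (simp add: quad_form_def sum_divide_distrib power2_eq_square)
  also have "(\<Sum>u\<in>V. \<Sum>v\<in>V. a u v) = 2 * (\<Sum>e\<in>{e\<in>E. e \<subseteq> V}. 1 - real r / 2 * w e)"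
    unfolding a_def by (rule sum_pairs_eq_sum_edges[OF V E(2)])
  also have "{e\<in>E. e \<subseteq> V} = E" using E by auto
  also have "(\<Sum>e\<in>E. 1 - real r / 2 * w e) = real (card E) - real r / 2 * sum w E"
    by (simp add: sum_subtractf sum_distrib_left)
  finally have "2 * (real (card E) - real r / 2 * sum w E) \<le> (real r - 2) / (real r - 1) * n\<^sup>2"
    using n by (subst (asm) pos_divide_le_eq) auto
  moreover have "c - p / 2 \<le> d" if "2 * (c - d) \<le> p" for c d p :: real
    using that by simp
  ultimately show ?thesis unfolding n_def[symmetric] times_divide_eq_right by blast
qed

section \<open>Approximate linear programming duality\<close>

text \<open>The factor comes from feasibility: at the penalised maximiser no edge has weight
  \<open>w\<close> above 1, so its load exceeds 1 by at most \<open>1 / M\<close>, and dividing by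
  \<open>1 + 1 / M\<close> gives a packing.\<close>

lemma approximate_clique_duality:
  assumes G: "simple_graph V E" and r: "r \<ge> 2" and M: "M > (1::real)"
  obtains w f where "\<And>e. e \<in> E \<Longrightarrow> w e \<ge> (0::real)"
    and "\<And>K. K \<in> cliques r V E \<Longrightarrow> (\<Sum>e\<in>{e\<in>E. e \<subseteq> K}. w e) \<ge> 1"
    and "fractional_clique_packing r V E f"
    and "sum w E \<le> (1 + 1 / M) * packing_size r V E f"
proof -
  define C where "C = cliques r V E"
  have C: "finite C" unfolding C_def by (rule finite_cliques[OF G])
  have E: "finite E" using G by (auto simp: simple_graph_def intro: finite_subset[of _ "Pow V"])
  define load where "load f e = (\<Sum>K\<in>{K\<in>C. e \<subseteq> K}. f K)" for f :: "'a set \<Rightarrow> real" and e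
  define obj where "obj f = sum f C - M / 2 * (\<Sum>e\<in>E. (max 0 (load f e - 1))\<^sup>2)" for f
  \<comment> \<open>The upper limit 2 only serves compactness: the maximiser has loads at most \<open>1 + 1 / M < 2\<close>.\<close>
  define B where "B = (\<Pi>\<^sub>E K\<in>UNIV. if K \<in> C then {0..2::real} else {0})"
  have B: "f \<in> B \<longleftrightarrow> (\<forall>K\<in>C. 0 \<le> f K \<and> f K \<le> 2) \<and> (\<forall>K. K \<notin> C \<longrightarrow> f K = 0)" for f
    by (auto simp: B_def PiE_iff split: if_splits)
  have "compact B" unfolding B_def by (intro compact_PiE_UNIV) auto
  moreover have "(\<lambda>_. 0) \<in> B" by (simp add: B)
  then have "B \<noteq> {}" by blast
  moreover have "continuous_on B obj" unfolding obj_def load_def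
    by (intro continuous_intros continuous_on_product_coordinates[THEN continuous_on_subset]) auto
  ultimately have "\<exists>g\<in>B. \<forall>f\<in>B. obj f \<le> obj g" by (rule continuous_attains_sup)
  then obtain g where gB: "g \<in> B" and gmax: "\<And>f. f \<in> B \<Longrightarrow> obj f \<le> obj g" by blast
  have g0: "g K \<ge> 0" if "K \<in> C" for K using gB B that by auto
  \<comment> \<open>This is the derivative of the penalty in the load of \<open>e\<close>, so the
    partial derivative of \<open>obj\<close> at the coordinate \<open>K\<close> is
    \<open>1 - W K\<close>.\<close>
  define w where "w e = M * max 0 (load g e - 1)" for e
  define W where "W K = (\<Sum>e\<in>{e\<in>E. e \<subseteq> K}. w e)" for K
  have w0: "w e \<ge> 0" for e using M by (simp add: w_def)
  have load_upd: "load (g(K := g K + h)) e = load g e + (if e \<subseteq> K then h else 0)" if "K \<in> C" for K h e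
  proof -
    have "load (g(K := g K + h)) e = (\<Sum>L\<in>{L\<in>C. e \<subseteq> L}. g L + (if L = K then h else 0))"
      unfolding load_def by (intro sum.cong) auto
    also have "\<dots> = load g e + (if e \<subseteq> K then h else 0)"
      using C that by (simp add: sum.distrib load_def sum.delta)
    finally show ?thesis .
  qed
  have stationary: "h * (1 - W K) \<le> M / 2 * card E * h\<^sup>2"
    if K: "K \<in> C" and h: "0 \<le> g K + h" "g K + h \<le> 2" for K h
  proof -
    \<comment> \<open>A quadratic upper estimate stands in for the derivative
      \<open>2 * max 0 t\<close> of the squared positive part.\<close>
    have sq: "(max 0 (t + s))\<^sup>2 \<le> (max 0 t)\<^sup>2 + 2 * s * max 0 t + s\<^sup>2" for t s :: real
    proof -
      have "(max 0 (t + s))\<^sup>2 \<le> (max 0 t + s)\<^sup>2"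
      proof (cases "t + s \<ge> 0")
        case True then show ?thesis by (intro power_mono) auto
      qed (simp add: max_def)
      then show ?thesis by (simp add: power2_eq_square algebra_simps)
    qed
    let ?f = "g(K := g K + h)"
    have "?f \<in> B" using gB K h by (auto simp: B)
    then have "obj ?f \<le> obj g" by (rule gmax)
    moreover have "sum ?f C = sum g C + h"
      using C K by (simp add: sum.remove[of C K])
    ultimately have "h \<le> M / 2 * ((\<Sum>e\<in>E. (max 0 (load ?f e - 1))\<^sup>2) - (\<Sum>e\<in>E. (max 0 (load g e - 1))\<^sup>2))"
      by (simp add: obj_def right_diff_distrib)
    also have "\<dots> = M / 2 * (\<Sum>e\<in>E. (max 0 (load ?f e - 1))\<^sup>2 - (max 0 (load g e - 1))\<^sup>2)"
      by (simp add: sum_subtractf)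
    also have "\<dots> \<le> M / 2 * (\<Sum>e\<in>E. (if e \<subseteq> K then 2 * h * max 0 (load g e - 1) else 0) + h\<^sup>2)"
    proof (intro mult_left_mono sum_mono)
      fix e
      show "(max 0 (load ?f e - 1))\<^sup>2 - (max 0 (load g e - 1))\<^sup>2
        \<le> (if e \<subseteq> K then 2 * h * max 0 (load g e - 1) else 0) + h\<^sup>2"
        using sq[of "load g e - 1" h] by (cases "e \<subseteq> K") (simp_all only: load_upd[OF K] add_diff_eq diff_add_eq if_True if_False, simp_all)
    qed (use M in auto)
    also have "\<dots> = h * W K + M / 2 * card E * h\<^sup>2"
      using E by (simp add: W_def w_def sum.distrib sum.inter_filter[symmetric] sum_distrib_left
        algebra_simps)
    finally show ?thesis by (simp add: algebra_simps)
  qed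
  \<comment> \<open>A positive coordinate may be decreased, so stationarity with negative increments
    applies.\<close>
  have W_le: "W K \<le> 1" if K: "K \<in> C" "g K > 0" for K
  proof -
    have "W K - 1 \<le> 0"
    proof (rule quadratic_bound_imp_nonpos)
      show "g K > 0" by (rule K)
      fix h assume h: "0 < h" "h \<le> g K"
      have "g K \<le> 2" using gB K B by auto
      then show "h * (W K - 1) \<le> M / 2 * card E * h\<^sup>2"
        using stationary[OF K(1), of "- h"] h by (simp add: algebra_simps)
    qed
    then show ?thesis by simp
  qed
  \<comment> \<open>Either \<open>e\<close> lies in a clique \<open>K\<close> of positive weight,
    and \<open>w e\<close> is one summand of \<open>W K\<close>, or \<open>e\<close> carries no load
    and \<open>w e = 0\<close>.\<close>
  have w_le: "w e \<le> 1" if e: "e \<in> E" for e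
  proof (cases "\<exists>K\<in>C. e \<subseteq> K \<and> g K > 0")
    case True
    then obtain K where K: "K \<in> C" "e \<subseteq> K" "g K > 0" by blast
    have "w e \<le> W K" unfolding W_def using e K E w0 by (intro member_le_sum) auto
    then show ?thesis using W_le K by force
  next
    case False
    then have "load g e \<le> 0" unfolding load_def by (intro sum_nonpos) force
    then show ?thesis by (simp add: w_def)
  qed
  have load_le: "load g e \<le> 1 + 1 / M" if "e \<in> E" for e
  proof -
    have "M * (load g e - 1) \<le> w e" unfolding w_def using M by (intro mult_left_mono) auto
    then have "M * (load g e - 1) \<le> 1" using w_le[OF that] by simp
    then show ?thesis using M by (simp add: field_simps)
  qed
  \<comment> \<open>The coordinate \<open>K\<close> may be increased: \<open>g K\<close> is at most
    the load of any edge inside \<open>K\<close>, hence below the upper limit 2.\<close>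
  have W_ge: "W K \<ge> 1" if K: "K \<in> C" for K
  proof -
    have "card K \<ge> 2" using K r by (auto simp: C_def cliques_def)
    then obtain e where e: "e \<subseteq> K" "card e = 2" by (meson obtain_subset_with_card_n)
    then have eE: "e \<in> E" using K by (auto simp: C_def cliques_def card_2_iff)
    have "g K \<le> load g e"
      unfolding load_def using C K e g0 by (intro member_le_sum) auto
    also have "\<dots> \<le> 1 + 1 / M" by (rule load_le[OF eE])
    also have "\<dots> < 2" using M by simp
    finally have g2: "2 - g K > 0" by simp
    have "1 - W K \<le> 0"
      by (rule quadratic_bound_imp_nonpos[OF g2, of _ "M / 2 * card E"]) (use stationary[OF K] g0[OF K] in auto)
    then show ?thesis by simp
  qed
  have W_eq: "g K * W K = g K" if "K \<in> C" for K
    using W_le[of K] W_ge[of K] g0[of K] that by (cases "g K = 0") auto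
  \<comment> \<open>Complementary slackness: \<open>W K = 1\<close> wherever \<open>g K > 0\<close>.
    Double counting pairs of an edge and a clique containing it turns the size of \<open>g\<close>
    into a sum of \<open>w e * load g e\<close>, and \<open>w e\<close> vanishes unless the load
    exceeds 1.\<close>
  have "sum g C = (\<Sum>K\<in>C. g K * W K)" by (simp add: W_eq)
  also have "\<dots> = (\<Sum>K\<in>C. \<Sum>e\<in>E. if e \<subseteq> K then g K * w e else 0)"
    using E by (auto simp: W_def sum_distrib_left sum.inter_filter intro!: sum.cong)
  also have "\<dots> = (\<Sum>e\<in>E. w e * load g e)"
    using C by (subst sum.swap) (auto simp: load_def sum_distrib_left sum.inter_filter mult.commute intro!: sum.cong)
  also have "\<dots> \<ge> (\<Sum>e\<in>E. w e)"
  proof (intro sum_mono)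
    fix e
    show "w e \<le> w e * load g e"
    proof (cases "load g e \<ge> 1")
      case True
      then show ?thesis using w0[of e] mult_left_mono[of 1 "load g e" "w e"] by simp
    qed (simp add: w_def)
  qed
  finally have size: "sum w E \<le> sum g C" .
  define f where "f K = g K / (1 + 1 / M)" for K
  have p: "1 + 1 / M > 0" using M by (simp add: add_pos_pos)
  have "fractional_clique_packing r V E f"
    unfolding fractional_clique_packing_def C_def[symmetric]
  proof (intro conjI ballI)
    show "f K \<ge> 0" if "K \<in> C" for K using g0[OF that] p by (simp add: f_def)
    fix e assume e: "e \<in> E"
    have "(\<Sum>K\<in>{K\<in>C. e \<subseteq> K}. f K) = load g e / (1 + 1 / M)"
      by (simp add: f_def load_def sum_divide_distrib)
    then show "(\<Sum>K\<in>{K\<in>C. e \<subseteq> K}. f K) \<le> 1" using load_le[OF e] p by simp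
  qed
  moreover have "packing_size r V E f = sum g C / (1 + 1 / M)"
    by (simp add: packing_size_def f_def C_def sum_divide_distrib)
  then have "sum w E \<le> (1 + 1 / M) * packing_size r V E f" using size p by simp
  ultimately show ?thesis
    using that[of w f] w0 W_ge by (auto simp: W_def C_def)
qed

section \<open>Combining the cover bound with duality\<close>

theorem theorem1p8:
  fixes r n :: nat and V :: "'a set" and E :: "'a set set" and k :: real
  assumes "r \<ge> 3"
    and "simple_graph V E"
    and "card V = n"
    and "real (card E) = (1 - 1 / (real r - 1)) * ((real n)\<^sup>2 / 2) + k"
  shows "fractional_clique_packing_number r V E \<ge> 2 * k / real r"
proof -
  have r: "r \<ge> 2" using assms(1) by simp
  define N where "N = fractional_clique_packing_number r V E"
  have bound: "2 * k / real r \<le> (1 + 1 / M) * N" if M: "M > 1" for M :: real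
  proof -
    obtain w f where w: "\<And>e. e \<in> E \<Longrightarrow> w e \<ge> (0::real)"
        "\<And>K. K \<in> cliques r V E \<Longrightarrow> (\<Sum>e\<in>{e\<in>E. e \<subseteq> K}. w e) \<ge> 1"
      and f: "fractional_clique_packing r V E f" "sum w E \<le> (1 + 1 / M) * packing_size r V E f"
      using approximate_clique_duality[OF assms(2) r M] by blast
    have "1 - 1 / (real r - 1) = (real r - 2) / (real r - 1)" using r by (simp add: field_simps)
    then have "k \<le> real r / 2 * sum w E"
      using fractional_clique_cover_ge[OF r assms(2) w] assms(3,4) by simp
    then have "2 * k / real r \<le> sum w E" using r by (simp add: field_simps)
    also have "\<dots> \<le> (1 + 1 / M) * packing_size r V E f" by (rule f)
    also have "\<dots> \<le> (1 + 1 / M) * N"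
      using fractional_clique_packing_number_is_max(2)[OF assms(2) r f(1)] M
      by (intro mult_left_mono) (auto simp: N_def)
    finally show ?thesis .
  qed
  \<comment> \<open>Since \<open>N\<close> does not depend on \<open>M\<close>, the duality factor
    disappears as \<open>M\<close> tends to infinity.\<close>
  have "((\<lambda>M. (1 + 1 / M) * N) \<longlongrightarrow> (1 + 0) * N) at_top"
    by (intro tendsto_intros tendsto_divide_0[OF tendsto_const] filterlim_at_top_imp_at_infinity
      filterlim_ident)
  moreover have "eventually (\<lambda>M. 2 * k / real r \<le> (1 + 1 / M) * N) at_top"
    using eventually_gt_at_top[of 1] by eventually_elim (rule bound)
  ultimately have "2 * k / real r \<le> (1 + 0) * N"
    by (intro tendsto_lowerbound) auto
  then show ?thesis by (simp add: N_def)
qed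

end
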